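(* Let $\mathbf{x}_i, \mathbf{x}'_i \in \mathbb{R}^m$ for $i = 1, \ldots, n$, let $1 \le d \le m$, and let $\boldsymbol{\Gamma} = \frac{1}{2n} \sum_{i=1}^n \left( \mathbf{x}_i {\mathbf{x}'_i}^\top + \mathbf{x}'_i \mathbf{x}_i^\top \right) \in \mathbb{R}^{m \times m}$, with eigenvalues $\gamma_1 \ge \cdots \ge \gamma_m$ and with $\boldsymbol{\Gamma}^{(\le d)} \in \mathbb{R}^{d \times m}$ the matrix whose rows are the top $d$ (orthonormal) eigenvectors of $\boldsymbol{\Gamma}$. Let $\mathbf{W}(t) \in \mathbb{R}^{d \times m}$, $t \ge 0$, be the solution of the gradient flow $\frac{d\mathbf{W}}{dt} = -\nabla_{\mathbf{W}} \mathcal{L}(\mathbf{W})$ of the loss $\mathcal{L}(\mathbf{W}) = \| \mathbf{W} \boldsymbol{\Gamma} \mathbf{W}^\top - \mathbf{I}_d \|_F^2$, that is, of $$\frac{d \mathbf{W}}{dt} = -4 \left( \mathbf{W} \boldsymbol{\Gamma} \mathbf{W}^\top - \mathbf{I}_d \right) \mathbf{W} \boldsymbol{\Gamma},$$ with initial condition $$\mathbf{W}(0) = \mathbf{U} \mathbf{S}_0 \boldsymbol{\Gamma}^{(\le d)}, \qquad \mathbf{S}_0 = \mathrm{diag}(s_1(0), \ldots, s_d(0)),$$ where $\mathbf{U} \in \mathbb{R}^{d \times d}$ is an arbitrary orthogonal matrix and $s_j(0) > 0$ for all $j = 1, \ldots, d$. Then for all $t \ge 0$, $$\mathbf{W}(t)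 = \mathbf{U} \mathbf{S}(t) \boldsymbol{\Gamma}^{(\le d)}$$ with $\mathbf{S}(t) = \mathrm{diag}(s_1(t), \ldots, s_d(t))$ and $$s_j(t) = \frac{e^{4 \gamma_j t}}{\sqrt{s_j^{-2}(0) + (e^{8 \gamma_j t} - 1) \gamma_j}}.$$
   Context: $\|\cdot\|_F$ denotes the Frobenius norm and $\mathbf{I}_d$ the $d \times d$ identity matrix. $\boldsymbol{\Gamma}$ is symmetric but may have eigenvalues of any sign; row $j$ of $\boldsymbol{\Gamma}^{(\le d)}$ is a unit eigenvector with eigenvalue $\gamma_j$, and the rows are mutually orthonormal. $s_j^{-2}(0)$ means $1/s_j(0)^2$. *)

theory Defs
  imports "HOL-Analysis.Analysis"
begin

definition outer :: "real^'m \<Rightarrow> real^'n \<Rightarrow> real^'n^'m" where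
  "outer x y = (\<chi> i j. x $ i * y $ j)"

definition cross_moment ::
    "nat \<Rightarrow> (nat \<Rightarrow> real^'m) \<Rightarrow> (nat \<Rightarrow> real^'m) \<Rightarrow> real^'m^'m" where
  "cross_moment n x x' =
     (1 / (2 * real n)) *\<^sub>R (\<Sum>i = 1..n. outer (x i) (x' i) + outer (x' i) (x i))"

definition diag :: "real^'d \<Rightarrow> real^'d^'d" where
  "diag s = (\<chi> i j. if i = j then s $ i else 0)"

text \<open>The rows of a matrix with row index type \<^typ>\<open>'d\<close> are counted from the top by the order
  on \<^typ>\<open>'d\<close>: the least index has number 1 and the greatest has number \<open>CARD('d)\<close>.\<close>

definition row_number :: "'d::{finite,linorder} \<Rightarrow> nat" where
  "row_number j = card {..j}"

text \<open>\<open>\<gamma> 1 \<ge> \<dots> \<ge> \<gamma> CARD('m)\<close> are the eigenvalues of \<open>A\<close>, that is, the roots of its characteristic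
  polynomial, repeated according to multiplicity. Values of \<open>\<gamma>\<close> at other arguments play no role.\<close>

definition sorted_eigenvalues :: "real^'m^'m \<Rightarrow> (nat \<Rightarrow> real) \<Rightarrow> bool" where
  "sorted_eigenvalues A \<gamma> \<longleftrightarrow>
     (\<forall>z. det (mat z - A) = (\<Prod>k = 1..CARD('m). z - \<gamma> k)) \<and>
     antimono_on {1..CARD('m)} \<gamma>"

definition top_eigenvectors ::
    "real^'m^'m \<Rightarrow> (nat \<Rightarrow> real) \<Rightarrow> real^'m^('d::{finite,linorder}) \<Rightarrow> bool" where
  "top_eigenvectors A \<gamma> V \<longleftrightarrow>
     (\<forall>j. A *v row j V = \<gamma> (row_number j) *\<^sub>R row j V) \<and>
     (\<forall>i j. row i V \<bullet> row j V = (if i = j then 1 else 0))"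

text \<open>The Euclidean norm and inner product of the type \<^typ>\<open>real^'m^'d\<close> are the Frobenius ones.\<close>

definition loss :: "real^'m^'m \<Rightarrow> real^'m^'d \<Rightarrow> real" where
  "loss \<Gamma> W = (norm (W ** \<Gamma> ** transpose W - mat 1))\<^sup>2"

text \<open>A solution lives on \<open>t \<ge> 0\<close>; the derivative at \<open>0\<close> is one-sided.\<close>

definition gradient_flow :: "('a::real_inner \<Rightarrow> real) \<Rightarrow> (real \<Rightarrow> 'a) \<Rightarrow> bool" where
  "gradient_flow f W \<longleftrightarrow>
     (\<forall>t\<ge>0. \<exists>G. GDERIV f (W t) :> G \<and> (W has_vector_derivative - G) (at t within {0..}))"

definition scales ::
    "(nat \<Rightarrow> real) \<Rightarrow> real^('d::{finite,linorder}) \<Rightarrow> real \<Rightarrow> real^('d::{finite,linorder})" where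
  "scales \<gamma> s0 t =
     (\<chi> j. exp (4 * \<gamma> (row_number j) * t) /
           sqrt (1 / (s0 $ j)\<^sup>2 + (exp (8 * \<gamma> (row_number j) * t) - 1) * \<gamma> (row_number j)))"

end

theory Submission
  imports Defs
begin

text \<open>At \<open>W = U S V\<close>, where \<open>U\<close> is orthogonal, \<open>S\<close> is diagonal and the rows of \<open>V\<close> are orthonormal
  eigenvectors of \<open>\<Gamma>\<close>, the gradient of the loss is again of the form \<open>U D V\<close> with \<open>D\<close> diagonal. So
  the flow restricted to such \<open>W\<close> decouples into the Bernoulli equations
  \<open>s' = 4 g s - 4 g\<^sup>2 s\<^sup>3\<close>, one for each eigenvalue \<open>g\<close>, which the closed formula solves.
  The gradient is cubic in \<open>W\<close>, hence Lipschitz on balls, so by a Gronwall estimate this is the only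
  solution.\<close>

section \<open>Matrix products, transposes and the Frobenius inner product\<close>

lemma bounded_bilinear_matrix_mult:
  "bounded_bilinear ((**) :: real^'n^'m \<Rightarrow> real^'k^'n \<Rightarrow> real^'k^'m)"
proof -
  have "bilinear ((**) :: real^'n^'m \<Rightarrow> real^'k^'n \<Rightarrow> real^'k^'m)"
    unfolding bilinear_def
    by (auto intro!: linearI simp: vec_eq_iff matrix_matrix_mult_def sum.distrib
        sum_distrib_left algebra_simps)
  then show ?thesis
    by (simp add: bilinear_conv_bounded_bilinear)
qed

lemmas matrix_mult_diff_left = bounded_bilinear.diff_left[OF bounded_bilinear_matrix_mult]
lemmas matrix_mult_scaleR_left = bounded_bilinear.scaleR_left[OF bounded_bilinear_matrix_mult]
lemmas matrix_mult_scaleR_right = bounded_bilinear.scaleR_right[OF bounded_bilinear_matrix_mult]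

lemma bounded_linear_transpose: "bounded_linear (transpose :: real^'n^'m \<Rightarrow> real^'m^'n)"
  unfolding linear_conv_bounded_linear[symmetric]
  by (auto intro!: linearI simp: vec_eq_iff transpose_def)

lemma bounded_linear_diag: "bounded_linear (diag :: real^'d \<Rightarrow> real^'d^'d)"
  unfolding linear_conv_bounded_linear[symmetric]
  by (auto intro!: linearI simp: vec_eq_iff diag_def)

lemma transpose_diff: "transpose (A - B) = transpose A - transpose (B :: real^'n^'m)"
  by (simp add: vec_eq_iff transpose_def)

lemma inner_transpose: "inner (transpose A) (transpose B) = inner A (B :: real^'n^'m)"
  unfolding inner_vec_def transpose_def by (simp add: sum.swap[of _ "UNIV :: 'n set"])

text \<open>Row \<open>i\<close> of \<open>B ** C\<close> is \<open>B $ i v* C\<close>, so the claim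
  is the adjointness of \<open>C\<close> and \<open>transpose C\<close> summed over rows. It serves
  to isolate the direction \<open>H\<close> in the derivative of the loss.\<close>

lemma inner_matrix_mult_left:
  "inner A (B ** C) = inner (A ** transpose C) (B :: real^'k^'m)" for A :: "real^'n^'m"
proof -
  have "inner (row i A) (B $ i v* C) = inner (A $ i v* transpose C) (B $ i)" for i
    using dot_lmul_matrix[of "B $ i" C "A $ i"]
    by (simp add: inner_commute row_def vec_nth_inverse)
  then show ?thesis
    by (simp add: inner_vec_def[of A] inner_vec_def[of _ B] row_def vec_nth_inverse
        matrix_matrix_mult_def vector_matrix_mult_def mult.commute)
qed

section \<open>The gradient of the loss\<close>

text \<open>The loss is \<open>inner M M\<close>, so its derivative along \<open>H\<close> is twice
  the inner product of \<open>M\<close> with the derivative of \<open>M\<close>. By the product rule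
  the latter has two terms, and each contributes \<open>inner H (M ** W ** \<Gamma>)\<close>; hence
  the factor 4.\<close>

lemma GDERIV_loss:
  fixes \<Gamma> :: "real^'m^'m" and W :: "real^'m^'d"
  assumes sym: "transpose \<Gamma> = \<Gamma>"
  shows "GDERIV (loss \<Gamma>) W :> 4 *\<^sub>R ((W ** \<Gamma> ** transpose W - mat 1) ** W ** \<Gamma>)"
proof -
  note FD = bounded_bilinear.FDERIV[OF bounded_bilinear_matrix_mult]
  define M where "M = W ** \<Gamma> ** transpose W - mat 1"
  have symM: "transpose M = M"
    by (simp add: M_def transpose_diff matrix_transpose_mul sym matrix_mul_assoc)
  have D: "((\<lambda>W. W ** \<Gamma> ** transpose W - mat 1) has_derivative
        (\<lambda>H. W ** \<Gamma> ** transpose H + H ** \<Gamma> ** transpose W)) (at W)"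
    by (auto intro!: derivative_eq_intros FD
        bounded_linear.has_derivative[OF bounded_linear_transpose]
        simp: bounded_bilinear.zero_right[OF bounded_bilinear_matrix_mult])
  have "inner (W ** \<Gamma> ** transpose H + H ** \<Gamma> ** transpose W) M = 2 * inner H (M ** W ** \<Gamma>)" for H
  proof -
    have "inner M (H ** \<Gamma> ** transpose W) = inner (M ** W ** \<Gamma>) H"
      by (simp add: inner_matrix_mult_left sym)
    \<comment> \<open>The two terms are transposes of each other because \<open>\<Gamma>\<close> is
      symmetric. Transposition preserves the inner product and fixes \<open>M\<close>.\<close>
    moreover have "inner M (W ** \<Gamma> ** transpose H) = inner M (H ** \<Gamma> ** transpose W)"
      using inner_transpose[of M "H ** \<Gamma> ** transpose W"]
      by (simp add: symM matrix_transpose_mul sym matrix_mul_assoc)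
    ultimately show ?thesis
      by (simp add: inner_add_right inner_commute)
  qed
  then show ?thesis
    unfolding gderiv_def loss_def power2_norm_eq_inner
    using bounded_bilinear.FDERIV[OF bounded_bilinear_inner D D]
    by (simp add: M_def[symmetric] inner_commute)
qed

lemma GDERIV_unique:
  assumes "GDERIV f x :> D" "GDERIV f x :> E"
  shows "D = E"
proof -
  have "(\<lambda>h. inner h D) = (\<lambda>h. inner h E)"
    using assms unfolding gderiv_def by (rule has_derivative_unique)
  then show ?thesis
    by (simp add: fun_eq_iff vector_eq_ldot)
qed

lemma transpose_cross_moment: "transpose (cross_moment n x x') = cross_moment n x x'"
  by (simp add: vec_eq_iff transpose_def cross_moment_def outer_def sum_component add.commute
      mult.commute)

section \<open>Lipschitz estimates on balls and uniqueness of solutions\<close>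

lemma lipschitz_on_bounded_image:
  assumes "C-lipschitz_on X f" "bounded X"
  shows "bounded (f ` X)"
proof (cases "X = {}")
  case False
  then obtain a where a: "a \<in> X"
    by blast
  then obtain e where e: "\<And>x. x \<in> X \<Longrightarrow> dist a x \<le> e"
    using assms(2) bounded_any_center[of X a] by auto
  have "dist (f a) (f x) \<le> C * e" if "x \<in> X" for x
    using lipschitz_onD[OF assms(1) a that] e[OF that] lipschitz_on_nonneg[OF assms(1)]
    by (meson mult_left_mono order_trans)
  then show ?thesis
    unfolding bounded_def by blast
qed simp

text \<open>Changing one factor at a time leaves the other factor as a coefficient. Boundedness of
  \<open>X\<close> bounds that coefficient, which is why the estimate is stated on bounded
  sets.\<close>

lemma (in bounded_bilinear) lipschitz_on_prod:
  assumes "C-lipschitz_on X f" "D-lipschitz_on X g"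
    and "bounded X"
  shows "\<exists>L. L-lipschitz_on X (\<lambda>x. prod (f x) (g x))"
proof -
  obtain K where K: "K \<ge> 0" "\<And>a b. norm (prod a b) \<le> norm a * norm b * K"
    using nonneg_bounded by blast
  have "bounded (f ` X)" "bounded (g ` X)"
    using assms by (auto intro: lipschitz_on_bounded_image)
  then obtain A B where "\<And>x. x \<in> X \<Longrightarrow> norm (f x) \<le> A" "\<And>x. x \<in> X \<Longrightarrow> norm (g x) \<le> B"
    and AB: "A > 0" "B > 0"
    unfolding bounded_pos by auto
  note bd = this
  have CD: "C \<ge> 0" "D \<ge> 0"
    using assms lipschitz_on_nonneg by blast+
  have "(C * B * K + A * D * K)-lipschitz_on X (\<lambda>x. prod (f x) (g x))"
  proof (rule lipschitz_onI)
    fix x y assume xy: "x \<in> X" "y \<in> X"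
    have "prod (f x) (g x) - prod (f y) (g y) = prod (f x - f y) (g x) + prod (f y) (g x - g y)"
      by (simp add: diff_left diff_right)
    then have "dist (prod (f x) (g x)) (prod (f y) (g y))
        \<le> norm (f x - f y) * norm (g x) * K + norm (f y) * norm (g x - g y) * K"
      unfolding dist_norm by (metis K(2) norm_triangle_mono)
    also have "\<dots> \<le> (C * dist x y) * B * K + A * (D * dist x y) * K"
      using xy bd K CD AB lipschitz_onD[OF assms(1) xy] lipschitz_onD[OF assms(2) xy]
      by (intro add_mono mult_mono) (auto simp: dist_norm)
    finally show "dist (prod (f x) (g x)) (prod (f y) (g y)) \<le> (C * B * K + A * D * K) * dist x y"
      by (simp add: algebra_simps)
  qed (use K CD AB in auto)
  then show ?thesis ..
qed

text \<open>By compactness both solutions stay in one ball up to time \<open>t\<close>, so Lipschitz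
  constants on balls suffice. With \<open>L\<close> the constant there, the squared distance
  \<open>u\<close> satisfies \<open>u' \<le> 2 * L * u\<close>, and \<open>u\<close> starts at
  0.\<close>

lemma autonomous_ode_unique:
  fixes F :: "'a::real_inner \<Rightarrow> 'a"
  assumes lip: "\<And>R. \<exists>L. L-lipschitz_on (cball 0 R) F"
    and V: "\<And>t. t \<ge> 0 \<Longrightarrow> (V has_vector_derivative F (V t)) (at t within {0..})"
    and W: "\<And>t. t \<ge> 0 \<Longrightarrow> (W has_vector_derivative F (W t)) (at t within {0..})"
    and init: "V 0 = W 0"
    and t: "t \<ge> 0"
  shows "V t = W t"
proof -
  have "continuous_on {0..t} f"
    if "\<And>s. s \<ge> 0 \<Longrightarrow> (f has_vector_derivative F (f s)) (at s within {0..})" for f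
    by (rule continuous_on_vector_derivative)
       (rule has_vector_derivative_within_subset[OF that], auto)
  then have contV: "continuous_on {0..t} V" and contW: "continuous_on {0..t} W"
    using V W by blast+
  have "bounded (V ` {0..t} \<union> W ` {0..t})"
    using contV contW by (simp add: compact_continuous_image compact_imp_bounded)
  then obtain R where "\<And>u. u \<in> V ` {0..t} \<union> W ` {0..t} \<Longrightarrow> norm u \<le> R"
    by (auto simp: bounded_iff)
  then have R: "V s \<in> cball 0 R" "W s \<in> cball 0 R" if "s \<in> {0..t}" for s
    using that by (auto simp: dist_norm)
  obtain L where L: "L-lipschitz_on (cball 0 R) F"
    using lip by blast
  \<comment> \<open>The weight absorbs the growth rate \<open>2 * L\<close> of the squared distance,
    so that \<open>\<phi>\<close> cannot increase.\<close>
  define \<phi> where "\<phi> s = inner (V s - W s) (V s - W s) * exp (- 2 * L * s)" for s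
  have "\<phi> t \<le> \<phi> 0"
  \<comment> \<open>This rule asks for derivatives only in the open interval, where the one-sided
    derivatives of the hypotheses are two-sided. At the endpoints continuity is enough.\<close>
  proof (rule DERIV_nonpos_imp_decreasing_open[OF t])
    fix s assume s: "0 < s" "s < t"
    have at: "at s within {0..} = at s"
      using s by (intro at_within_interior) auto
    define E where "E = F (V s) - F (W s)"
    have D: "((\<lambda>s. V s - W s) has_vector_derivative E) (at s)"
      unfolding E_def using s V[of s] W[of s] at by (auto intro: has_vector_derivative_diff)
    have "((\<lambda>s. inner (V s - W s) (V s - W s)) has_real_derivative 2 * inner (V s - W s) E) (at s)"
      using bounded_bilinear.has_vector_derivative[OF bounded_bilinear_inner D D]
      by (simp add: has_real_derivative_iff_has_vector_derivative inner_commute)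
    moreover have "((\<lambda>s. exp (- 2 * L * s)) has_real_derivative - 2 * L * exp (- 2 * L * s)) (at s)"
      by (auto intro!: derivative_eq_intros)
    ultimately have "(\<phi> has_real_derivative
        2 * (inner (V s - W s) E - L * inner (V s - W s) (V s - W s)) * exp (- 2 * L * s)) (at s)"
      unfolding \<phi>_def by (rule DERIV_cong[OF DERIV_mult]) (simp add: algebra_simps)
    moreover have "inner (V s - W s) E \<le> L * inner (V s - W s) (V s - W s)"
    proof -
      have "norm E \<le> L * norm (V s - W s)"
        unfolding E_def using lipschitz_on_normD[OF L] R s by simp
      then have "norm (V s - W s) * norm E \<le> norm (V s - W s) * (L * norm (V s - W s))"
        by (intro mult_left_mono) auto
      then show ?thesis
        using norm_cauchy_schwarz[of "V s - W s" E]
        by (simp add: power2_norm_eq_inner[symmetric] power2_eq_square algebra_simps)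
    qed
    ultimately show "\<exists>y. DERIV \<phi> s :> y \<and> y \<le> 0"
      by (auto intro!: exI mult_nonpos_nonneg)
  next
    show "continuous_on {0..t} \<phi>"
      unfolding \<phi>_def by (intro continuous_intros contV contW)
  qed
  then have "inner (V t - W t) (V t - W t) \<le> 0"
    using init by (simp add: \<phi>_def mult_le_0_iff)
  then show ?thesis
    by (metis inner_gt_zero_iff not_less right_minus_eq)
qed

text \<open>The expression is assembled from the identity, \<open>transpose\<close> and constants by
  repeated use of the product estimate.\<close>

lemma lipschitz_on_cball_loss_gradient:
  fixes \<Gamma> :: "real^'m^'m"
  shows "\<exists>L. L-lipschitz_on (cball 0 R)
    (\<lambda>W :: real^'m^'d. - (4 *\<^sub>R ((W ** \<Gamma> ** transpose W - mat 1) ** W ** \<Gamma>)))"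
proof -
  let ?B = "cball (0 :: real^'m^'d) R"
  note prod = bounded_bilinear.lipschitz_on_prod[OF bounded_bilinear_matrix_mult _ _ bounded_cball]
  have id: "1-lipschitz_on ?B (\<lambda>W. W)" and c: "0-lipschitz_on ?B (\<lambda>W. \<Gamma>)"
    by (auto intro: lipschitz_intros)
  obtain T where T: "T-lipschitz_on ?B transpose"
    using bounded_linear.lipschitz_boundE[OF bounded_linear_transpose] by metis
  obtain A where A: "A-lipschitz_on ?B (\<lambda>W. W ** \<Gamma>)"
    using prod[OF id c] by blast
  obtain B where "B-lipschitz_on ?B (\<lambda>W. W ** \<Gamma> ** transpose W)"
    using prod[OF A T] by blast
  then have "(B + 0)-lipschitz_on ?B (\<lambda>W. W ** \<Gamma> ** transpose W - mat 1)"
    by (intro lipschitz_intros)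
  from prod[OF this id] obtain C
    where C: "C-lipschitz_on ?B (\<lambda>W. (W ** \<Gamma> ** transpose W - mat 1) ** W)"
    by blast
  obtain D where "D-lipschitz_on ?B (\<lambda>W. (W ** \<Gamma> ** transpose W - mat 1) ** W ** \<Gamma>)"
    using prod[OF C c] by blast
  then have "(\<bar>4\<bar> * D)-lipschitz_on ?B
      (\<lambda>W. - (4 *\<^sub>R ((W ** \<Gamma> ** transpose W - mat 1) ** W ** \<Gamma>)))"
    by (intro lipschitz_on_minus lipschitz_on_cmult)
  then show ?thesis ..
qed

section \<open>The gradient on the diagonal family\<close>

lemma diag_mult_diag: "diag a ** diag b = diag (\<chi> i. a $ i * b $ i)"
  by (simp add: vec_eq_iff diag_def matrix_matrix_mult_def if_distrib[of "\<lambda>u. u * _"]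
      if_distrib[of "\<lambda>u. _ * u"] cong: if_cong)

lemma transpose_diag: "transpose (diag a) = diag a"
  by (simp add: vec_eq_iff diag_def transpose_def)

lemma diag_diff: "diag a - diag b = diag (\<chi> i. a $ i - b $ i)"
  by (simp add: vec_eq_iff diag_def)

lemma diag_scaleR: "c *\<^sub>R diag a = diag (\<chi> i. c * a $ i)"
  by (simp add: vec_eq_iff diag_def)

text \<open>Symmetry turns the column equations \<open>A *v row j V\<close> into equations for row
  vectors. In this form a factor \<open>A\<close> to the right of \<open>V\<close> can be traded for
  a diagonal one to its left.\<close>

lemma top_eigenvectors_mult:
  assumes "top_eigenvectors A \<gamma> V" "transpose A = A"
  shows "V ** A = diag (\<chi> j. \<gamma> (row_number j)) ** V"
proof -
  have "row i V v* A = \<gamma> (row_number i) *\<^sub>R row i V" for i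
    using assms by (metis top_eigenvectors_def vector_transpose_matrix)
  then have "(\<Sum>k\<in>UNIV. V $ i $ k * A $ k $ j) = \<gamma> (row_number i) * V $ i $ j" for i j
    by (simp add: vec_eq_iff vector_matrix_mult_def row_def mult.commute)
  then show ?thesis
    by (simp add: vec_eq_iff diag_def matrix_matrix_mult_def if_distrib[of "\<lambda>u. u * _"]
        cong: if_cong)
qed

lemma top_eigenvectors_orthonormal:
  assumes "top_eigenvectors A \<gamma> V"
  shows "V ** transpose V = mat 1"
  using assms by (simp add: top_eigenvectors_def matrix_mult_transpose_dot_row vec_eq_iff mat_def)

text \<open>Once \<open>\<Gamma>\<close> is traded for \<open>diag l\<close>, the inner factors
  \<open>V ** transpose V\<close> and \<open>transpose U ** U\<close> cancel. Only diagonal matrices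
  remain between \<open>U\<close> and \<open>V\<close>, and they multiply entrywise.\<close>

lemma loss_gradient_decoupled:
  assumes orth: "orthogonal_matrix U"
    and eig: "V ** \<Gamma> = diag l ** V"
    and ortho: "V ** transpose V = mat 1"
    and W: "W = U ** diag s ** V"
  shows "- (4 *\<^sub>R ((W ** \<Gamma> ** transpose W - mat 1) ** W ** \<Gamma>)) =
    U ** diag (\<chi> j. 4 * l $ j * s $ j - 4 * (l $ j)\<^sup>2 * s $ j ^ 3) ** V"
proof -
  have UU: "transpose U ** U = mat 1" "U ** transpose U = mat 1"
    using orth by (auto simp: orthogonal_matrix_def)
  have WG: "W ** \<Gamma> = U ** diag (\<chi> j. s $ j * l $ j) ** V"
    by (simp add: W eig diag_mult_diag flip: matrix_mul_assoc)
       (simp add: diag_mult_diag matrix_mul_assoc)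
  have "W ** \<Gamma> ** transpose W
      = U ** diag (\<chi> j. s $ j * l $ j) ** (V ** transpose V) ** diag s ** transpose U"
    unfolding WG by (simp add: W matrix_transpose_mul transpose_diag matrix_mul_assoc)
  also have "\<dots> = U ** diag (\<chi> j. s $ j * l $ j * s $ j) ** transpose U"
    by (simp add: ortho diag_mult_diag flip: matrix_mul_assoc)
  finally have "(W ** \<Gamma> ** transpose W - mat 1) ** (W ** \<Gamma>) =
      U ** diag (\<chi> j. s $ j * l $ j * s $ j) ** (transpose U ** U) ** diag (\<chi> j. s $ j * l $ j) ** V
      - U ** diag (\<chi> j. s $ j * l $ j) ** V"
    by (simp add: WG matrix_mult_diff_left matrix_mul_assoc)
  also have "\<dots> = U ** (diag (\<chi> j. s $ j * l $ j * s $ j) ** diag (\<chi> j. s $ j * l $ j)) ** V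
      - U ** diag (\<chi> j. s $ j * l $ j) ** V"
    by (simp add: UU matrix_mul_assoc)
  also have "\<dots> = U ** diag (\<chi> j. (l $ j)\<^sup>2 * s $ j ^ 3 - l $ j * s $ j) ** V"
    by (simp add: diag_mult_diag diag_diff power2_eq_square power3_eq_cube mult_ac
        flip: bounded_bilinear.diff_left[OF bounded_bilinear_matrix_mult]
        bounded_bilinear.diff_right[OF bounded_bilinear_matrix_mult])
  finally have "- (4 *\<^sub>R ((W ** \<Gamma> ** transpose W - mat 1) ** W ** \<Gamma>)) =
      U ** ((- 4) *\<^sub>R diag (\<chi> j. (l $ j)\<^sup>2 * s $ j ^ 3 - l $ j * s $ j)) ** V"
    by (simp add: matrix_mul_assoc matrix_mult_scaleR_left matrix_mult_scaleR_right
        del: scaleR_minus_left flip: scaleR_minus_left)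
  then show ?thesis
    by (simp add: diag_scaleR algebra_simps)
qed

section \<open>The scalar Bernoulli equation\<close>

text \<open>For \<open>t \<ge> 0\<close> the factor \<open>exp (8 * g * t) - 1\<close> never has the
  sign opposite to \<open>g\<close>. So the closed formula makes sense for all times, even for
  negative eigenvalues.\<close>

lemma scale_denominator_pos:
  fixes g s t :: real
  assumes "s > 0" "t \<ge> 0"
  shows "1 / s\<^sup>2 + (exp (8 * g * t) - 1) * g > 0"
proof -
  have "(exp (8 * g * t) - 1) * g \<ge> 0"
    using assms by (cases "g \<ge> 0")
      (auto simp: zero_le_mult_iff mult_le_0_iff mult_nonneg_nonpos2 mult_nonpos_nonneg)
  then show ?thesis
    using assms by (intro add_pos_nonneg) auto
qed

text \<open>The substitution \<open>w = 1 / f^2\<close> makes the equation linear,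
  \<open>w' = 8 * g^2 - 8 * g * w\<close>, which is where the formula comes from. The check is
  direct: with \<open>f = E / sqrt D\<close>, \<open>E' = 4 * g * E\<close> and
  \<open>D' = 8 * g^2 * E^2\<close>, the quotient rule gives the two terms.\<close>

lemma scale_has_derivative:
  fixes g s t :: real
  assumes "s > 0" "t \<ge> 0"
  defines "f \<equiv> \<lambda>t. exp (4 * g * t) / sqrt (1 / s\<^sup>2 + (exp (8 * g * t) - 1) * g)"
  shows "(f has_real_derivative 4 * g * f t - 4 * g\<^sup>2 * f t ^ 3) (at t)"
proof -
  define E D where "E = exp (4 * g * t)" and "D = 1 / s\<^sup>2 + (exp (8 * g * t) - 1) * g"
  have D: "D > 0"
    unfolding D_def by (rule scale_denominator_pos[OF assms(1,2)])
  have E8: "exp (8 * g * t) = E\<^sup>2"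
    by (simp add: E_def flip: exp_double)
  have dE: "((\<lambda>t. exp (4 * g * t)) has_real_derivative 4 * g * E) (at t)"
    unfolding E_def by (auto intro!: derivative_eq_intros)
  have "((\<lambda>t. 1 / s\<^sup>2 + (exp (8 * g * t) - 1) * g) has_real_derivative 8 * g\<^sup>2 * E\<^sup>2) (at t)"
    by (auto intro!: derivative_eq_intros simp: power2_eq_square[of g] simp flip: E8)
  then have dD: "((\<lambda>t. sqrt (1 / s\<^sup>2 + (exp (8 * g * t) - 1) * g)) has_real_derivative
      inverse (sqrt D) / 2 * (8 * g\<^sup>2 * E\<^sup>2)) (at t)"
    using D unfolding D_def by (intro DERIV_chain2[OF DERIV_real_sqrt])
  have "(f has_real_derivative
      (4 * g * E * sqrt D - E * (inverse (sqrt D) / 2 * (8 * g\<^sup>2 * E\<^sup>2))) / (sqrt D * sqrt D)) (at t)"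
    using DERIV_divide[OF dE dD] D unfolding f_def by (simp add: D_def E_def)
  then show ?thesis
  proof (rule DERIV_cong)
    \<comment> \<open>Writing \<open>E\<close> as \<open>q * f t\<close> leaves an identity of
      rational expressions in \<open>g\<close>, \<open>q\<close> and \<open>f t\<close>, free of
      roots and exponentials.\<close>
    define q where "q = sqrt D"
    have q: "q > 0"
      using D by (simp add: q_def)
    moreover have "E = q * f t"
      using q by (simp add: f_def E_def D_def q_def)
    ultimately show "(4 * g * E * sqrt D - E * (inverse (sqrt D) / 2 * (8 * g\<^sup>2 * E\<^sup>2))) / (sqrt D * sqrt D)
        = 4 * g * f t - 4 * g\<^sup>2 * f t ^ 3"
      unfolding q_def[symmetric] by (simp add: field_simps power2_eq_square power3_eq_cube)
  qed
qed

section \<open>From the scalar equations to the matrix flow\<close>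

lemma has_vector_derivative_vec:
  fixes f :: "real \<Rightarrow> real^'n"
  assumes "\<And>i. ((\<lambda>t. f t $ i) has_real_derivative f' $ i) F"
  shows "(f has_vector_derivative f') F"
proof -
  have "((\<lambda>t. \<Sum>i\<in>UNIV. f t $ i *\<^sub>R axis i 1) has_vector_derivative
      (\<Sum>i\<in>UNIV. f' $ i *\<^sub>R (axis i 1 :: real^'n))) F"
    using assms
    by (intro has_vector_derivative_sum
        bounded_linear.has_vector_derivative[OF bounded_linear_scaleR_left])
       (simp add: has_real_derivative_iff_has_vector_derivative)
  then show ?thesis
    by (simp add: basis_expansion flip: scalar_mult_eq_scaleR)
qed

text \<open>The first conjunct identifies the gradient flow with the explicit equation. Existence is
  stated alongside uniqueness so that the formula for every solution is not vacuous.\<close>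

theorem proposition4p1:
  fixes x x' :: "nat \<Rightarrow> real^'m"
    and n :: nat
    and \<Gamma> :: "real^'m^'m"
    and \<gamma> :: "nat \<Rightarrow> real"
    and \<Gamma>d :: "real^'m^('d::{finite,linorder})"
    and U :: "real^('d::{finite,linorder})^('d::{finite,linorder})"
    and s0 :: "real^('d::{finite,linorder})"
  assumes "n \<ge> 1"
    and "CARD('d) \<le> CARD('m)"
    and "\<Gamma> = cross_moment n x x'"
    and "sorted_eigenvalues \<Gamma> \<gamma>"
    and "top_eigenvectors \<Gamma> \<gamma> \<Gamma>d"
    and "orthogonal_matrix U"
    and "\<And>j. s0 $ j > 0"
  shows "(\<forall>W :: real^'m^('d::{finite,linorder}).
            GDERIV (loss \<Gamma>) W :> 4 *\<^sub>R ((W ** \<Gamma> ** transpose W - mat 1) ** W ** \<Gamma>)) \<and>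
         (\<exists>W :: real \<Rightarrow> real^'m^('d::{finite,linorder}).
            gradient_flow (loss \<Gamma>) W \<and> W 0 = U ** diag s0 ** \<Gamma>d) \<and>
         (\<forall>W :: real \<Rightarrow> real^'m^('d::{finite,linorder}).
            gradient_flow (loss \<Gamma>) W \<and> W 0 = U ** diag s0 ** \<Gamma>d \<longrightarrow>
              (\<forall>t\<ge>0. W t = U ** diag (scales \<gamma> s0 t) ** \<Gamma>d))"
proof -
  define grad :: "real^'m^'d::{finite,linorder} \<Rightarrow> real^'m^'d::{finite,linorder}"
    where "grad W = 4 *\<^sub>R ((W ** \<Gamma> ** transpose W - mat 1) ** W ** \<Gamma>)" for W
  define V where "V t = U ** diag (scales \<gamma> s0 t) ** \<Gamma>d" for t
  have sym: "transpose \<Gamma> = \<Gamma>"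
    by (simp add: assms(3) transpose_cross_moment)
  have grad: "GDERIV (loss \<Gamma>) W :> grad W" for W
    unfolding grad_def by (rule GDERIV_loss[OF sym])
  \<comment> \<open>Uniqueness of gradients forces the existential \<open>G\<close> in
    \<open>gradient_flow\<close> to be \<open>grad (W t)\<close>.\<close>
  have flow_iff: "gradient_flow (loss \<Gamma>) W \<longleftrightarrow>
      (\<forall>t\<ge>0. (W has_vector_derivative - grad (W t)) (at t within {0..}))" for W
    unfolding gradient_flow_def using grad GDERIV_unique by metis
  have V0: "V 0 = U ** diag s0 ** \<Gamma>d"
  proof -
    \<comment> \<open>At time 0 the formula reduces to \<open>1 / sqrt (1 / s^2)\<close>, which
      equals \<open>s\<close> because \<open>s > 0\<close>.\<close>
    have "scales \<gamma> s0 0 = s0"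
      using assms(7) by (simp add: vec_eq_iff scales_def real_sqrt_divide less_imp_le)
    then show ?thesis
      by (simp add: V_def)
  qed
  have V: "(V has_vector_derivative - grad (V t)) (at t within {0..})" if "t \<ge> 0" for t
  proof -
    define l :: "real^'d::{finite,linorder}" where "l = (\<chi> j. \<gamma> (row_number j))"
    let ?s' = "\<chi> j. 4 * l $ j * scales \<gamma> s0 t $ j - 4 * (l $ j)\<^sup>2 * scales \<gamma> s0 t $ j ^ 3"
    note mult = bounded_bilinear_matrix_mult
    have "((\<lambda>t. scales \<gamma> s0 t $ j) has_real_derivative ?s' $ j) (at t)" for j
      using scale_has_derivative[OF assms(7)[of j] that, of "\<gamma> (row_number j)"]
      by (simp add: scales_def l_def)
    then have "(scales \<gamma> s0 has_vector_derivative ?s') (at t)"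
      by (rule has_vector_derivative_vec)
    then have "(scales \<gamma> s0 has_vector_derivative ?s') (at t within {0..})"
      by (rule has_vector_derivative_at_within)
    \<comment> \<open>\<open>V t\<close> depends linearly on \<open>scales \<gamma> s0 t\<close>, so
      the derivative passes through \<open>diag\<close> and both products.\<close>
    then have "(V has_vector_derivative U ** diag ?s' ** \<Gamma>d) (at t within {0..})"
      unfolding V_def
      by (intro bounded_linear.has_vector_derivative[OF bounded_bilinear.bounded_linear_left[OF mult]]
          bounded_linear.has_vector_derivative[OF bounded_bilinear.bounded_linear_right[OF mult]]
          bounded_linear.has_vector_derivative[OF bounded_linear_diag])
    also have "U ** diag ?s' ** \<Gamma>d = - grad (V t)"
      unfolding grad_def
      by (rule loss_gradient_decoupled[symmetric])
         (use assms(5,6) sym in \<open>simp_all add: V_def l_def top_eigenvectors_mult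
            top_eigenvectors_orthonormal\<close>)
    finally show ?thesis .
  qed
  have lip: "\<exists>L. L-lipschitz_on (cball 0 R) (\<lambda>W. - grad W)" for R
    unfolding grad_def by (rule lipschitz_on_cball_loss_gradient)
  have "W t = V t"
    if W: "gradient_flow (loss \<Gamma>) W" and W0: "W 0 = U ** diag s0 ** \<Gamma>d" and t: "t \<ge> 0" for W t
  proof (rule autonomous_ode_unique[OF lip _ _ _ t])
    show "(W has_vector_derivative - grad (W s)) (at s within {0..})" if "s \<ge> 0" for s
      using W flow_iff that by blast
    show "(V has_vector_derivative - grad (V s)) (at s within {0..})" if "s \<ge> 0" for s
      using V that by blast
    show "W 0 = V 0"
      using W0 V0 by simp
  qed
  moreover have "gradient_flow (loss \<Gamma>) V"
    using V flow_iff by blast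
  ultimately show ?thesis
    using grad V0 unfolding grad_def V_def by blast
qed

end
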